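(* Let $\hbar$ be a nonzero real number, let $m$ and $p$ be real numbers, and let $E$ be a number with $1+\hbar E\neq 0$. Put $$\xi(E)=1+\hbar E,\qquad \eta(p)=\hbar p+\sqrt{1+(\hbar p)^2},\qquad f_E(\tau)=\xi(E)^{\tau/\hbar},\qquad g_p(x)=\eta(p)^{x/\hbar}.$$ Then $f_E(\tau)$ is an eigenfunction of the quantum derivative $\partial_\tau$ with eigenvalue $E$, $g_p(x)$ is an eigenfunction of the quantum derivative $\partial_x$ with eigenvalue $p$, and the function $\phi(\tau,x)=f_E(\tau)g_p(x)$ satisfies the quantum Klein-Gordon equation $$(\partial_\tau^2-\partial_x^2-\partial_y^2-\partial_z^2+m^2)(\phi(\tau,x))=0$$ if and only if $$\Bigl(\xi(E)\,\frac{(\eta(p)-1)^2}{2\hbar\,\eta(p)}+E\Bigr)^2-\xi(E)^2p^2+m^2=0.$$ This dispersion relation is equivalent to $$E^2-2p^2\,\frac{1+\hbar E}{1+\sqrt{1+(\hbar p)^2}}+m^2=0,$$ whose solutions in $E$ are $$E_\pm=\pm\sqrt{p^2-m^2}+\frac{\hbar p^2}{1+\sqrt{1+(\hbar p)^2}}.$$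
   Context: The noncommutative space-time algebra is generated by $\tau,x,y,z$ with relations $[x,y]=2i\hbar z$, $[y,z]=2i\hbar x$, $[z,x]=2i\hbar y$, and $\tau$ central. The quantum partial derivatives $\partial_\tau,\partial_x,\partial_y,\partial_z$ commute with each other and satisfy the permutation relations $[\partial_\tau,\tau]=1+\hbar\partial_\tau$, $[\partial_\tau,x]=\hbar\partial_x$, $[\partial_x,\tau]=\hbar\partial_x$, $[\partial_x,x]=1+\hbar\partial_\tau$, $[\partial_x,y]=i\hbar\partial_z$, $[\partial_x,z]=-i\hbar\partial_y$, together with those obtained by the cyclic permutations $x\to y\to z\to x$. A derivative $\partial$ acts on an element $n$ by moving the derivatives in $\partial\, n$ to the right using the permutation relations and then killing every term that ends with a derivative; the result is denoted $\partial(n)$. For polynomials, and by extension for arbitrary functions $f$ of $\tau$ and $g$ of $x$, this action on products $f(\tau)g(x)$ is given by $$\partial_\tau(f(\tau)g(x))=\frac{f(\tau+\hbar)-f(\tau)}{\hbar}\,g(x)+f(\tau+\hbar)\,\partial_\tau(g(x)),\qquad \partial_a(f(\tau)g(x))=f(\tau+\hbar)\,\partial_a(g(x))\quad (a\in\{x,y,z\}),$$ $$\partial_\tau(g(x))=\frac{g(x+\hbar)+g(x-\hbar)-2g(x)}{2\hbar},\qquad \partial_x(g(x))=\frac{g(x+\hbar)-g(x-\hbar)}{2\hbar},\qquad \partial_y(g(x))=\partial_z(g(x))=0.$$ Powers of derivatives act by iteration. The expression $\xi^{\tau/\hbar}$ means $\exp(\tau\ln(\xi)/\hbar)$ with a fixed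 value of $\ln\xi$, so that $f_E(\tau+\hbar)=\xi(E)f_E(\tau)$; likewise $\eta^{x/\hbar}=\exp(x\ln(\eta)/\hbar)$ with the real logarithm (note $\eta(p)>0$). *)

theory Defs
  imports Complex_Main
begin

text \<open>
  The generators \<open>\<tau>\<close> and \<open>x\<close> commute, and the subalgebra they generate is stable under all
  four quantum derivatives. Its elements, extended from polynomials to arbitrary functions, are
  represented as functions \<open>\<phi> \<tau> x\<close> of two real variables with complex values; an element depending
  on one variable only is constant in the other argument.
\<close>

type_synonym wave = "real \<Rightarrow> real \<Rightarrow> complex"

definition space_dtau :: "real \<Rightarrow> (real \<Rightarrow> complex) \<Rightarrow> real \<Rightarrow> complex" where
  "space_dtau h g x = (g (x + h) + g (x - h) - 2 * g x) / (2 * of_real h)"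

definition space_dx :: "real \<Rightarrow> (real \<Rightarrow> complex) \<Rightarrow> real \<Rightarrow> complex" where
  "space_dx h g x = (g (x + h) - g (x - h)) / (2 * of_real h)"

definition space_dy :: "real \<Rightarrow> (real \<Rightarrow> complex) \<Rightarrow> real \<Rightarrow> complex" where
  "space_dy h g x = 0"

definition space_dz :: "real \<Rightarrow> (real \<Rightarrow> complex) \<Rightarrow> real \<Rightarrow> complex" where
  "space_dz h g x = 0"

text \<open>
  The derivatives of a product \<open>f \<tau> * g x\<close> are given by the formulas in \<open>derivatives_of_product\<close>
  below. The definitions are their linear extension, needed because a derivative of a product is a
  sum of products and derivatives are iterated.
\<close>

definition dtau :: "real \<Rightarrow> wave \<Rightarrow> wave" where
  "dtau h \<phi> t x = (\<phi> (t + h) x - \<phi> t x) / of_real h + space_dtau h (\<phi> (t + h)) x"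

definition dx :: "real \<Rightarrow> wave \<Rightarrow> wave" where
  "dx h \<phi> t x = space_dx h (\<phi> (t + h)) x"

definition dy :: "real \<Rightarrow> wave \<Rightarrow> wave" where
  "dy h \<phi> t x = space_dy h (\<phi> (t + h)) x"

definition dz :: "real \<Rightarrow> wave \<Rightarrow> wave" where
  "dz h \<phi> t x = space_dz h (\<phi> (t + h)) x"

lemma derivatives_of_product:
  "dtau h (\<lambda>t x. f t * g x) t x
     = (f (t + h) - f t) / of_real h * g x + f (t + h) * space_dtau h g x"
  "dx h (\<lambda>t x. f t * g x) t x = f (t + h) * space_dx h g x"
  "dy h (\<lambda>t x. f t * g x) t x = f (t + h) * space_dy h g x"
  "dz h (\<lambda>t x. f t * g x) t x = f (t + h) * space_dz h g x"
  by (simp_all add: dtau_def dx_def dy_def dz_def space_dtau_def space_dx_def space_dy_def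
      space_dz_def algebra_simps add_divide_distrib diff_divide_distrib)

lemma derivatives_linear:
  "dtau h (\<lambda>t x. a * \<phi> t x + b * \<psi> t x) = (\<lambda>t x. a * dtau h \<phi> t x + b * dtau h \<psi> t x)"
  "dx h (\<lambda>t x. a * \<phi> t x + b * \<psi> t x) = (\<lambda>t x. a * dx h \<phi> t x + b * dx h \<psi> t x)"
  "dy h (\<lambda>t x. a * \<phi> t x + b * \<psi> t x) = (\<lambda>t x. a * dy h \<phi> t x + b * dy h \<psi> t x)"
  "dz h (\<lambda>t x. a * \<phi> t x + b * \<psi> t x) = (\<lambda>t x. a * dz h \<phi> t x + b * dz h \<psi> t x)"
  by (simp_all add: fun_eq_iff dtau_def dx_def dy_def dz_def space_dtau_def space_dx_def
      space_dy_def space_dz_def algebra_simps add_divide_distrib diff_divide_distrib)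

text \<open>
  Agreement with the permutation relations: they hold for these operators, and together with the
  rule that a derivative with nothing to its right vanishes they determine the action on
  polynomials in \<open>\<tau>\<close> and \<open>x\<close>.
\<close>

definition mult_tau :: "wave \<Rightarrow> wave" where
  "mult_tau \<phi> t x = of_real t * \<phi> t x"

definition mult_x :: "wave \<Rightarrow> wave" where
  "mult_x \<phi> t x = of_real x * \<phi> t x"

definition permutation_relations ::
  "real \<Rightarrow> (wave \<Rightarrow> wave) \<Rightarrow> (wave \<Rightarrow> wave) \<Rightarrow> (wave \<Rightarrow> wave) \<Rightarrow> (wave \<Rightarrow> wave) \<Rightarrow> wave \<Rightarrow> bool" where
  "permutation_relations h Dt Dx Dy Dz \<phi> \<longleftrightarrow>
     (\<forall>t x. Dt (mult_tau \<phi>) t x - mult_tau (Dt \<phi>) t x = \<phi> t x + of_real h * Dt \<phi> t x) \<and>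
     (\<forall>t x. Dx (mult_tau \<phi>) t x - mult_tau (Dx \<phi>) t x = of_real h * Dx \<phi> t x) \<and>
     (\<forall>t x. Dy (mult_tau \<phi>) t x - mult_tau (Dy \<phi>) t x = of_real h * Dy \<phi> t x) \<and>
     (\<forall>t x. Dz (mult_tau \<phi>) t x - mult_tau (Dz \<phi>) t x = of_real h * Dz \<phi> t x) \<and>
     (\<forall>t x. Dt (mult_x \<phi>) t x - mult_x (Dt \<phi>) t x = of_real h * Dx \<phi> t x) \<and>
     (\<forall>t x. Dx (mult_x \<phi>) t x - mult_x (Dx \<phi>) t x = \<phi> t x + of_real h * Dt \<phi> t x) \<and>
     (\<forall>t x. Dy (mult_x \<phi>) t x - mult_x (Dy \<phi>) t x = - \<i> * of_real h * Dz \<phi> t x) \<and>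
     (\<forall>t x. Dz (mult_x \<phi>) t x - mult_x (Dz \<phi>) t x = \<i> * of_real h * Dy \<phi> t x)"

lemma derivatives_permutation_relations:
  assumes "h \<noteq> 0"
  shows "permutation_relations h (dtau h) (dx h) (dy h) (dz h) \<phi>"
  using assms
  by (simp add: permutation_relations_def mult_tau_def mult_x_def dtau_def dx_def dy_def dz_def
      space_dtau_def space_dx_def space_dy_def space_dz_def field_simps)

lemma derivatives_commute:
  "dtau h (dx h \<phi>) = dx h (dtau h \<phi>)"
  "dtau h (dy h \<phi>) = dy h (dtau h \<phi>)" "dtau h (dz h \<phi>) = dz h (dtau h \<phi>)"
  "dx h (dy h \<phi>) = dy h (dx h \<phi>)" "dx h (dz h \<phi>) = dz h (dx h \<phi>)"
  "dy h (dz h \<phi>) = dz h (dy h \<phi>)"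
  by (simp_all add: fun_eq_iff dtau_def dx_def dy_def dz_def space_dtau_def space_dx_def
      space_dy_def space_dz_def algebra_simps add_divide_distrib diff_divide_distrib)

lemma derivatives_unique_on_monomials:
  fixes j k :: nat
  defines "mon \<equiv> \<lambda>j k. (mult_tau ^^ j) ((mult_x ^^ k) (\<lambda>t x. 1))"
  assumes h: "h \<noteq> 0"
    and rel: "\<And>j k. permutation_relations h Dt Dx Dy Dz (mon j k)"
    and kill: "\<And>D. D \<in> {Dt, Dx, Dy, Dz} \<Longrightarrow> D (\<lambda>t x. 1) = (\<lambda>t x. 0)"
  shows "Dt (mon j k) = dtau h (mon j k)" "Dx (mon j k) = dx h (mon j k)"
    "Dy (mon j k) = dy h (mon j k)" "Dz (mon j k) = dz h (mon j k)"
proof -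
  define agree where "agree \<phi> \<longleftrightarrow>
    Dt \<phi> = dtau h \<phi> \<and> Dx \<phi> = dx h \<phi> \<and> Dy \<phi> = dy h \<phi> \<and> Dz \<phi> = dz h \<phi>" for \<phi>
  have step: "agree (mult_tau \<phi>) \<and> agree (mult_x \<phi>)"
    if a: "agree \<phi>" and r: "permutation_relations h Dt Dx Dy Dz \<phi>" for \<phi>
  proof -
    have r': "permutation_relations h (dtau h) (dx h) (dy h) (dz h) \<phi>"
      by (rule derivatives_permutation_relations[OF h])
    show ?thesis
      using a r r' unfolding agree_def permutation_relations_def fun_eq_iff
      by (simp add: mult_tau_def mult_x_def diff_eq_eq)
  qed
  have base: "agree (\<lambda>t x. 1)"
    using kill by (simp add: agree_def fun_eq_iff dtau_def dx_def dy_def dz_def space_dtau_def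
        space_dx_def space_dy_def space_dz_def)
  have x: "agree (mon 0 k)" for k
  proof (induction k)
    case 0
    then show ?case using base by (simp add: mon_def)
  next
    case (Suc k)
    then show ?case using step[OF _ rel[of 0 k]] by (simp add: mon_def)
  qed
  have "agree (mon j k)"
  proof (induction j)
    case 0
    then show ?case by (rule x)
  next
    case (Suc j)
    then show ?case using step[OF _ rel[of j k]] by (simp add: mon_def)
  qed
  then show "Dt (mon j k) = dtau h (mon j k)" "Dx (mon j k) = dx h (mon j k)"
    "Dy (mon j k) = dy h (mon j k)" "Dz (mon j k) = dz h (mon j k)"
    by (simp_all add: agree_def)
qed

definition eigenfunction :: "(wave \<Rightarrow> wave) \<Rightarrow> complex \<Rightarrow> wave \<Rightarrow> bool" where
  "eigenfunction D c \<phi> \<longleftrightarrow> (\<exists>t x. \<phi> t x \<noteq> 0) \<and> (\<forall>t x. D \<phi> t x = c * \<phi> t x)"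

definition klein_gordon :: "real \<Rightarrow> real \<Rightarrow> wave \<Rightarrow> wave" where
  "klein_gordon h m \<phi> t x =
     (dtau h ^^ 2) \<phi> t x - (dx h ^^ 2) \<phi> t x - (dy h ^^ 2) \<phi> t x - (dz h ^^ 2) \<phi> t x
     + (of_real m)\<^sup>2 * \<phi> t x"

definition xi :: "real \<Rightarrow> complex \<Rightarrow> complex" where
  "xi h E = 1 + of_real h * E"

definition eta :: "real \<Rightarrow> real \<Rightarrow> real" where
  "eta h p = h * p + sqrt (1 + (h * p)\<^sup>2)"

text \<open>
  \<open>xi h E\<close> raised to \<open>\<tau> / h\<close>, where \<open>L\<close> is the chosen value of its logarithm, i.e. any complex number
  with \<open>exp L = xi h E\<close>.
\<close>

definition time_wave :: "real \<Rightarrow> complex \<Rightarrow> real \<Rightarrow> complex" where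
  "time_wave h L t = exp (of_real t * L / of_real h)"

definition space_wave :: "real \<Rightarrow> real \<Rightarrow> real \<Rightarrow> complex" where
  "space_wave h p x = of_real (exp (x * ln (eta h p) / h))"

end

theory Submission
  imports Defs
begin

text \<open>
  A shift by \<open>h\<close> multiplies \<open>f\<^sub>E\<close> by \<open>\<xi> = 1 + h * E\<close> and multiplies \<open>g\<^sub>p\<close> by
  \<open>\<eta> = h * p + S\<close>, where \<open>S = sqrt (1 + (h * p)\<^sup>2)\<close>. The quantum derivatives are difference operators,
  so on the product they act as scalars: \<open>\<partial>\<^sub>\<tau>\<close> by \<open>E + \<xi> * \<kappa>\<close>, \<open>\<partial>\<^sub>x\<close> by \<open>\<xi> * p\<close>, and \<open>\<partial>\<^sub>y\<close>, \<open>\<partial>\<^sub>z\<close> by zero,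
  where \<open>\<kappa> = (\<eta> + 1 / \<eta> - 2) / (2 * h)\<close> is the eigenvalue of \<open>\<partial>\<^sub>\<tau>\<close> on \<open>g\<^sub>p\<close>
  (lemma \<open>derivatives_plane_wave\<close>). The Klein-Gordon operator is therefore multiplication by
  \<open>(\<xi> * \<kappa> + E)\<^sup>2 - \<xi>\<^sup>2 * p\<^sup>2 + m\<^sup>2\<close>, and the plane wave vanishes nowhere.

  The rest is algebra. Since \<open>1 / \<eta> = S - h * p\<close>, the number \<open>\<kappa>\<close> equals \<open>(S - 1) / h = h * p\<^sup>2 / (1 + S)\<close>
  and satisfies \<open>\<kappa>\<^sup>2 + 2 * \<kappa> / h = p\<^sup>2\<close> (lemma \<open>kappa_quadratic\<close>). This relation turns the terms
  quadratic in \<open>\<xi>\<close> into \<open>- 2 * \<kappa> * \<xi>\<^sup>2 / h\<close>; writing one factor as \<open>1 + h * E\<close> cancels the mixed term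
  \<open>2 * \<xi> * \<kappa> * E\<close> and leaves \<open>E\<^sup>2 - 2 * \<kappa> * \<xi> / h + m\<^sup>2\<close>. The same relation completes the square:
  the last expression is \<open>(E - \<kappa>)\<^sup>2 - (p\<^sup>2 - m\<^sup>2)\<close>.
\<close>

text \<open>
  The eigenvalue of \<open>\<partial>\<^sub>\<tau>\<close> on \<open>g\<^sub>p\<close>, written in the form in which it enters the solutions \<open>E\<^sub>\<plusminus>\<close>, as the
  midpoint between them.
\<close>

definition kappa :: "real \<Rightarrow> real \<Rightarrow> real" where
  "kappa h p = h * p\<^sup>2 / (1 + sqrt (1 + (h * p)\<^sup>2))"

lemma sqrt_one_plus_square_pos: "1 + sqrt (1 + (a :: real)\<^sup>2) > 0"
  by (simp add: add_pos_nonneg)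

text \<open>The conjugate factors \<open>S + h * p\<close> and \<open>S - h * p\<close> have product \<open>1\<close>.\<close>

lemma eta_inverse: "inverse (eta h p) = sqrt (1 + (h * p)\<^sup>2) - h * p"
proof (rule inverse_unique)
  have "(sqrt (1 + (h * p)\<^sup>2))\<^sup>2 = 1 + (h * p)\<^sup>2"
    by simp
  then show "eta h p * (sqrt (1 + (h * p)\<^sup>2) - h * p) = 1"
    unfolding eta_def by (simp add: algebra_simps power2_eq_square)
qed

lemma eta_pos: "eta h p > 0"
proof -
  have "sqrt ((h * p)\<^sup>2) < sqrt (1 + (h * p)\<^sup>2)"
    by (rule real_sqrt_less_mono) simp
  then show ?thesis
    unfolding eta_def by simp
qed

lemma kappa_eq_sqrt:
  assumes "h \<noteq> 0"
  shows "kappa h p = (sqrt (1 + (h * p)\<^sup>2) - 1) / h"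
proof -
  have "(sqrt (1 + (h * p)\<^sup>2) - 1) * (1 + sqrt (1 + (h * p)\<^sup>2)) = (h * p)\<^sup>2"
    by (simp add: algebra_simps power2_eq_square[symmetric])
  then show ?thesis
    using assms sqrt_one_plus_square_pos[of "h * p"]
    unfolding kappa_def by (simp add: frac_eq_eq power2_eq_square)
qed

lemma kappa_eq_eta_inverse:
  assumes "h \<noteq> 0"
  shows "kappa h p = (eta h p + inverse (eta h p) - 2) / (2 * h)"
proof -
  have "eta h p + inverse (eta h p) = 2 * sqrt (1 + (h * p)\<^sup>2)"
    unfolding eta_inverse by (simp add: eta_def)
  then show ?thesis
    using assms by (simp add: kappa_eq_sqrt field_simps)
qed

lemma kappa_eq_eta:
  assumes "h \<noteq> 0"
  shows "kappa h p = (eta h p - 1)\<^sup>2 / (2 * h * eta h p)"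
  using assms eta_pos[of h p]
  by (simp add: kappa_eq_eta_inverse field_simps power2_eq_square)

text \<open>
  With \<open>S = 1 + h * \<kappa>\<close> this is the identity \<open>S\<^sup>2 = 1 + (h * p)\<^sup>2\<close> divided by \<open>h\<^sup>2\<close>.
\<close>

lemma kappa_quadratic:
  assumes "h \<noteq> 0"
  shows "(kappa h p)\<^sup>2 + 2 * kappa h p / h = p\<^sup>2"
proof -
  have S: "sqrt (1 + (h * p)\<^sup>2) = 1 + h * kappa h p"
    using assms by (simp add: kappa_eq_sqrt)
  have "(1 + h * kappa h p)\<^sup>2 = 1 + (h * p)\<^sup>2"
    unfolding S[symmetric] by simp
  then have "h * h * ((kappa h p)\<^sup>2 + 2 * kappa h p / h) = h * h * p\<^sup>2"
    using assms by (simp add: algebra_simps power2_eq_square)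
  then show ?thesis
    using assms by simp
qed

lemma time_wave_shift:
  assumes "h \<noteq> 0" and "exp L = xi h E"
  shows "time_wave h L (t + h) = xi h E * time_wave h L t"
proof -
  have "of_real (t + h) * L / of_real h = L + of_real t * L / of_real h"
    using assms(1) by (simp add: field_simps)
  then show ?thesis
    unfolding time_wave_def assms(2)[symmetric] by (simp only: exp_add)
qed

lemma space_wave_shift:
  assumes "h \<noteq> 0"
  shows "space_wave h p (x + h) = of_real (eta h p) * space_wave h p x"
    and "space_wave h p (x - h) = of_real (inverse (eta h p)) * space_wave h p x"
proof -
  have fwd: "space_wave h p (y + h) = of_real (eta h p) * space_wave h p y" for y
  proof -
    have "(y + h) * ln (eta h p) / h = ln (eta h p) + y * ln (eta h p) / h"
      using assms by (simp add: field_simps)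
    then show ?thesis
      unfolding space_wave_def using eta_pos[of h p] by (simp add: exp_add)
  qed
  then show "space_wave h p (x + h) = of_real (eta h p) * space_wave h p x" .
  show "space_wave h p (x - h) = of_real (inverse (eta h p)) * space_wave h p x"
    using fwd[of "x - h"] eta_pos[of h p] by (simp add: field_simps)
qed

lemma space_derivatives_space_wave:
  assumes "h \<noteq> 0"
  shows "space_dtau h (space_wave h p) x = of_real (kappa h p) * space_wave h p x"
    and "space_dx h (space_wave h p) x = of_real p * space_wave h p x"
proof -
  show "space_dtau h (space_wave h p) x = of_real (kappa h p) * space_wave h p x"
    using assms unfolding space_dtau_def space_wave_shift[OF assms] kappa_eq_eta_inverse[OF assms]
    by (simp add: algebra_simps add_divide_distrib diff_divide_distrib)
  have "eta h p - inverse (eta h p) = 2 * h * p"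
    unfolding eta_inverse by (simp add: eta_def)
  then have "complex_of_real (eta h p) - of_real (inverse (eta h p)) = 2 * of_real h * of_real p"
    by (metis of_real_diff of_real_mult of_real_numeral)
  then have "space_wave h p (x + h) - space_wave h p (x - h)
      = 2 * of_real h * of_real p * space_wave h p x"
    unfolding space_wave_shift[OF assms] by (metis left_diff_distrib)
  then show "space_dx h (space_wave h p) x = of_real p * space_wave h p x"
    unfolding space_dx_def using assms by simp
qed

text \<open>
  Allowing a scalar \<open>c\<close> in front of the plane wave makes these rules applicable a second time, to the
  result of a first derivative.
\<close>

lemma derivatives_plane_wave:
  fixes c :: complex and p :: real
  assumes "h \<noteq> 0" and "exp L = xi h E"
  defines "\<phi> \<equiv> \<lambda>t x. time_wave h L t * space_wave h p x"
  shows "dtau h (\<lambda>t x. c * \<phi> t x) = (\<lambda>t x. (xi h E * of_real (kappa h p) + E) * c * \<phi> t x)"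
    and "dx h (\<lambda>t x. c * \<phi> t x) = (\<lambda>t x. xi h E * of_real p * c * \<phi> t x)"
proof -
  have E: "(xi h E - 1) / of_real h = E"
    using assms(1) by (simp add: xi_def)
  have prod: "(\<lambda>t x. c * \<phi> t x) = (\<lambda>t x. (c * time_wave h L t) * space_wave h p x)"
    unfolding \<phi>_def by (simp add: mult.assoc)
  have diff: "(c * time_wave h L (t + h) - c * time_wave h L t) / of_real h
      = E * c * time_wave h L t" for t
  proof -
    have "(c * time_wave h L (t + h) - c * time_wave h L t) / of_real h
        = (xi h E - 1) / of_real h * (c * time_wave h L t)"
      unfolding time_wave_shift[OF assms(1,2)] by (simp add: algebra_simps diff_divide_distrib)
    then show ?thesis
      unfolding E by simp
  qed
  show "dtau h (\<lambda>t x. c * \<phi> t x) = (\<lambda>t x. (xi h E * of_real (kappa h p) + E) * c * \<phi> t x)"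
    unfolding prod fun_eq_iff derivatives_of_product diff space_derivatives_space_wave[OF assms(1)]
    by (simp add: \<phi>_def time_wave_shift[OF assms(1,2)] algebra_simps)
  show "dx h (\<lambda>t x. c * \<phi> t x) = (\<lambda>t x. xi h E * of_real p * c * \<phi> t x)"
    unfolding prod fun_eq_iff derivatives_of_product space_derivatives_space_wave[OF assms(1)]
      time_wave_shift[OF assms(1,2)]
    by (simp add: \<phi>_def algebra_simps)
qed

lemma time_wave_eigenfunction:
  assumes "h \<noteq> 0" and "exp L = xi h E"
  shows "eigenfunction (dtau h) E (\<lambda>t x. time_wave h L t)"
  using assms(1) unfolding eigenfunction_def dtau_def space_dtau_def time_wave_shift[OF assms]
  by (auto simp: time_wave_def xi_def field_simps)

lemma space_wave_eigenfunction:
  assumes "h \<noteq> 0"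
  shows "eigenfunction (dx h) (of_real p) (\<lambda>t x. space_wave h p x)"
  unfolding eigenfunction_def dx_def space_derivatives_space_wave[OF assms]
  by (simp add: space_wave_def)

lemma klein_gordon_plane_wave:
  fixes p :: real
  assumes "h \<noteq> 0" and "exp L = xi h E"
  defines "\<phi> \<equiv> \<lambda>t x. time_wave h L t * space_wave h p x"
  shows "klein_gordon h m \<phi> t x
    = ((xi h E * of_real (kappa h p) + E)\<^sup>2 - (xi h E)\<^sup>2 * (of_real p)\<^sup>2 + (of_real m)\<^sup>2) * \<phi> t x"
proof -
  note rules = derivatives_plane_wave[OF assms(1,2), where p = p]
  have "(dtau h ^^ 2) \<phi> t x = (xi h E * of_real (kappa h p) + E)\<^sup>2 * \<phi> t x"
    using rules(1)[of 1] rules(1)[of "xi h E * of_real (kappa h p) + E"]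
    unfolding \<phi>_def by (simp add: numeral_2_eq_2)
  moreover have "(dx h ^^ 2) \<phi> t x = (xi h E)\<^sup>2 * (of_real p)\<^sup>2 * \<phi> t x"
    using rules(2)[of 1] rules(2)[of "xi h E * of_real p"]
    unfolding \<phi>_def by (simp add: numeral_2_eq_2 mult_ac)
  moreover have "(dy h ^^ 2) \<phi> t x = 0" and "(dz h ^^ 2) \<phi> t x = 0"
    by (simp_all add: numeral_2_eq_2 dy_def dz_def space_dy_def space_dz_def)
  ultimately show ?thesis
    unfolding klein_gordon_def by (simp add: algebra_simps)
qed

text \<open>
  Here \<open>k\<close> and \<open>M\<close> stand for \<open>\<kappa>\<close> and \<open>m\<^sup>2\<close>. Replacing \<open>p\<^sup>2\<close> by \<open>k\<^sup>2 + 2 * k / h\<close> turns both identities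
  below into identities between rational functions.
\<close>

lemma dispersion_reduce:
  fixes h k p E M :: "'a :: field"
  assumes "h \<noteq> 0" and "k\<^sup>2 + 2 * k / h = p\<^sup>2"
  shows "((1 + h * E) * k + E)\<^sup>2 - (1 + h * E)\<^sup>2 * p\<^sup>2 + M = E\<^sup>2 - 2 * (k / h) * (1 + h * E) + M"
  using assms(1) unfolding assms(2)[symmetric]
  by (simp add: field_simps power2_eq_square)

lemma dispersion_complete_square:
  fixes h k p E M :: "'a :: field"
  assumes "h \<noteq> 0" and "k\<^sup>2 + 2 * k / h = p\<^sup>2"
  shows "E\<^sup>2 - 2 * (k / h) * (1 + h * E) + M = (E - k)\<^sup>2 - (p\<^sup>2 - M)"
  using assms(1) unfolding assms(2)[symmetric]
  by (simp add: field_simps power2_eq_square)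

theorem mainTheorem1:
  fixes h m p :: real and E L :: complex
  assumes "h \<noteq> 0"
    and "1 + of_real h * E \<noteq> 0"
    and "exp L = xi h E"
  shows "eigenfunction (dtau h) E (\<lambda>t x. time_wave h L t) \<and>
    eigenfunction (dx h) (of_real p) (\<lambda>t x. space_wave h p x) \<and>
    ((\<forall>t x. klein_gordon h m (\<lambda>t x. time_wave h L t * space_wave h p x) t x = 0)
      \<longleftrightarrow> (xi h E * of_real ((eta h p - 1)\<^sup>2 / (2 * h * eta h p)) + E)\<^sup>2
            - (xi h E)\<^sup>2 * (of_real p)\<^sup>2 + (of_real m)\<^sup>2 = 0) \<and>
    ((xi h E * of_real ((eta h p - 1)\<^sup>2 / (2 * h * eta h p)) + E)\<^sup>2
            - (xi h E)\<^sup>2 * (of_real p)\<^sup>2 + (of_real m)\<^sup>2 = 0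
      \<longleftrightarrow> E\<^sup>2 - 2 * (of_real p)\<^sup>2 * ((1 + of_real h * E) / of_real (1 + sqrt (1 + (h * p)\<^sup>2)))
            + (of_real m)\<^sup>2 = 0) \<and>
    {E' :: complex. E'\<^sup>2 - 2 * (of_real p)\<^sup>2
              * ((1 + of_real h * E') / of_real (1 + sqrt (1 + (h * p)\<^sup>2))) + (of_real m)\<^sup>2 = 0}
      = {csqrt (of_real (p\<^sup>2 - m\<^sup>2)) + of_real (h * p\<^sup>2 / (1 + sqrt (1 + (h * p)\<^sup>2))),
         - csqrt (of_real (p\<^sup>2 - m\<^sup>2)) + of_real (h * p\<^sup>2 / (1 + sqrt (1 + (h * p)\<^sup>2)))}"
proof -
  define k where "k = complex_of_real (kappa h p)"
  have h: "complex_of_real h \<noteq> 0"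
    using assms(1) by simp
  have "complex_of_real ((kappa h p)\<^sup>2 + 2 * kappa h p / h) = of_real (p\<^sup>2)"
    using kappa_quadratic[OF assms(1)] by simp
  then have quad: "k\<^sup>2 + 2 * k / of_real h = (of_real p)\<^sup>2"
    by (simp add: k_def)
  have k_eta: "complex_of_real ((eta h p - 1)\<^sup>2 / (2 * h * eta h p)) = k"
    unfolding k_def kappa_eq_eta[OF assms(1)] ..
  have k_sqrt: "complex_of_real (h * p\<^sup>2 / (1 + sqrt (1 + (h * p)\<^sup>2))) = k"
    unfolding k_def kappa_def ..
  have coeff: "2 * (of_real p)\<^sup>2 * ((1 + of_real h * e) / of_real (1 + sqrt (1 + (h * p)\<^sup>2)))
      = 2 * (k / of_real h) * (1 + of_real h * e)" for e :: complex
    using h unfolding k_sqrt[symmetric] by simp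
  have root: "e\<^sup>2 - 2 * (k / of_real h) * (1 + of_real h * e) + (of_real m)\<^sup>2 = 0
      \<longleftrightarrow> e = csqrt (of_real (p\<^sup>2 - m\<^sup>2)) + k \<or> e = - csqrt (of_real (p\<^sup>2 - m\<^sup>2)) + k"
    for e :: complex
  proof -
    have "e\<^sup>2 - 2 * (k / of_real h) * (1 + of_real h * e) + (of_real m)\<^sup>2
        = (e - k)\<^sup>2 - (csqrt (of_real (p\<^sup>2 - m\<^sup>2)))\<^sup>2"
      unfolding dispersion_complete_square[OF h quad] power2_csqrt by simp
    also have "\<dots> = 0 \<longleftrightarrow> e - k = csqrt (of_real (p\<^sup>2 - m\<^sup>2)) \<or> e - k = - csqrt (of_real (p\<^sup>2 - m\<^sup>2))"
      by (simp only: right_minus_eq power2_eq_iff)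
    finally show ?thesis
      by (simp only: diff_eq_eq)
  qed
  have nonzero: "time_wave h L t * space_wave h p x \<noteq> 0" for t x
    by (simp add: time_wave_def space_wave_def)
  show ?thesis
    unfolding k_eta k_sqrt coeff root
  proof (intro conjI)
    show "eigenfunction (dtau h) E (\<lambda>t x. time_wave h L t)"
      by (rule time_wave_eigenfunction[OF assms(1,3)])
    show "eigenfunction (dx h) (of_real p) (\<lambda>t x. space_wave h p x)"
      by (rule space_wave_eigenfunction[OF assms(1)])
    show "(\<forall>t x. klein_gordon h m (\<lambda>t x. time_wave h L t * space_wave h p x) t x = 0)
        \<longleftrightarrow> (xi h E * k + E)\<^sup>2 - (xi h E)\<^sup>2 * (of_real p)\<^sup>2 + (of_real m)\<^sup>2 = 0"
      unfolding klein_gordon_plane_wave[OF assms(1,3)] k_def using nonzero by simp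
    show "(xi h E * k + E)\<^sup>2 - (xi h E)\<^sup>2 * (of_real p)\<^sup>2 + (of_real m)\<^sup>2 = 0
        \<longleftrightarrow> E = csqrt (of_real (p\<^sup>2 - m\<^sup>2)) + k \<or> E = - csqrt (of_real (p\<^sup>2 - m\<^sup>2)) + k"
      unfolding xi_def dispersion_reduce[OF h quad] root ..
    show "{E'. E' = csqrt (of_real (p\<^sup>2 - m\<^sup>2)) + k \<or> E' = - csqrt (of_real (p\<^sup>2 - m\<^sup>2)) + k}
        = {csqrt (of_real (p\<^sup>2 - m\<^sup>2)) + k, - csqrt (of_real (p\<^sup>2 - m\<^sup>2)) + k}"
      by blast
  qed
qed

end
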